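(* Let $h:[0,1]^2\to\mathbb{R}$ be a $C^2$ function with $D_2D_1h<0$ on $[0,1]^2$, and let $\varphi:X\to\mathbb{R}$ be given by $\varphi(\underline{x})=h(x_0,x_1)$. Let $h^\ast=\min_{x\in[0,1]}h(x,x)$ and $\mathrm{m}=\{a\in[0,1]: h(a,a)=h^\ast\}$. Then: (1) $\alpha_\varphi=h^\ast$. (2) $\mathcal{M}_{\min}(\varphi)\cap\mathcal{M}^{\mathrm p}=\{\delta_{a^\infty}: a\in\mathrm{m}\}$. (3) $\Omega_\varphi\subset\mathrm{m}^{\mathbb{N}_0}$, i.e., for any $\underline{x}=\{x_i\}_{i\in\mathbb{N}_0}\in\Omega_\varphi$ we have $h(x_i,x_i)=h^\ast$ for all $i\in\mathbb{N}_0$. If, in addition, $x\mapsto h(x,x)$ has a unique minimum point $a_\ast$ in $[0,1]$, then the Mather set of $\varphi$ coincides with the Aubry set of $\varphi$, and it consists of the single fixed point $a_\ast^\infty$.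
   Context: $\mathbb{N}_0$ is the set of non-negative integers and $X=[0,1]^{\mathbb{N}_0}$ with metric $d(\underline{x},\underline{y})=\sum_{i\ge 0}|x_i-y_i|/2^i$; $\sigma:X\to X$ is the left shift, $(\sigma(\underline{x}))_i=x_{i+1}$. $D_i$ denotes the partial derivative in the $i$-th variable. For $a\in[0,1]$, $a^\infty=(a,a,a,\dots)\in X$, and $\delta_{\underline{x}}$ is the Dirac measure at $\underline{x}$. For continuous $\varphi:X\to\mathbb{R}$, $\alpha_\varphi=\inf_\mu\int\varphi\,d\mu$ over all $\sigma$-invariant Borel probability measures $\mu$ on $X$; $\mathcal{M}_{\min}(\varphi)$ is the set of such $\mu$ with $\int\varphi\,d\mu=\alpha_\varphi$; $\mathcal{M}^{\mathrm p}$ is the set of $\sigma$-invariant probability measures supported on a single periodic orbit. The Mather set is $\mathscr{M}_\varphi=\bigcup_{\mu\in\mathcal{M}_{\min}(\varphi)}\mathrm{supp}(\mu)$. For $\psi:X\to\mathbb{R}$ and $n\in\mathbb{N}=\{1,2,\dots\}$, $S_n\psi=\sum_{i=0}^{n-1}\psi\circ\sigma^i$. With $B(\underline{x},\underline{y},n;\varepsilon)=\{\underline{z}\in X: d(\underline{x},\underline{z})<\varepsilon,\ d(\sigma^n(\underline{z}),\underline{y})<\varepsilon\}$, the Mañé potential is $S_\varphi(\underline{x},\underline{y})=\lim_{\varepsilon\to0}\inf\{S_n(\varphi-\alpha_\varphi)(\underline{z}): n\in\mathbb{N},\ \underline{z}\in B(\underline{x},\underline{y},n;\varepsilon)\}$,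 and the Aubry set is $\Omega_\varphi=\{\underline{x}\in X: S_\varphi(\underline{x},\underline{x})=0\}$. *)

theory Defs
  imports "HOL-Probability.Probability"
begin

section \<open>The sequence space\<close>

definition seq_space :: "(nat \<Rightarrow> real) set" where
  "seq_space = (UNIV \<rightarrow> {0..1})"

definition seq_dist :: "(nat \<Rightarrow> real) \<Rightarrow> (nat \<Rightarrow> real) \<Rightarrow> real" where
  "seq_dist x y = (\<Sum>i. \<bar>x i - y i\<bar> / 2 ^ i)"

definition left_shift :: "(nat \<Rightarrow> real) \<Rightarrow> (nat \<Rightarrow> real)" where
  "left_shift x = (\<lambda>i. x (Suc i))"

text \<open>The topology on \<^const>\<open>seq_space\<close> used below is the subspace topology of the
  library's product topology on \<^typ>\<open>nat \<Rightarrow> real\<close>; lemma \<open>openin_seq_space_iff\<close> shows that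
  it is the topology of \<^const>\<open>seq_dist\<close>.\<close>

lemma abs_diff_le_1:
  assumes "x \<in> seq_space" "y \<in> seq_space"
  shows "\<bar>x i - y i\<bar> \<le> 1"
proof -
  have "x i \<in> {0..1}" "y i \<in> {0..1}" using assms by (auto simp: seq_space_def Pi_iff)
  then show ?thesis by auto
qed

lemma seq_dist_term_le:
  assumes "x \<in> seq_space" "y \<in> seq_space"
  shows "norm (\<bar>x i - y i\<bar> / 2 ^ i) \<le> (1/2) ^ i"
  using abs_diff_le_1[OF assms, of i] by (simp add: power_divide divide_simps)

lemma seq_dist_summable:
  assumes "x \<in> seq_space" "y \<in> seq_space"
  shows "summable (\<lambda>i. \<bar>x i - y i\<bar> / 2 ^ i)"
  by (rule summable_comparison_test'[where g = "\<lambda>i. (1/2) ^ i" and N = 0])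
     (use seq_dist_term_le[OF assms] in \<open>auto simp: summable_geometric\<close>)

lemma seq_dist_coord:
  assumes "x \<in> seq_space" "y \<in> seq_space"
  shows "\<bar>x i - y i\<bar> \<le> 2 ^ i * seq_dist x y"
proof -
  have "(\<Sum>j\<in>{i}. \<bar>x j - y j\<bar> / 2 ^ j) \<le> seq_dist x y"
    unfolding seq_dist_def by (rule sum_le_suminf) (use seq_dist_summable[OF assms] in auto)
  then show ?thesis by (simp add: divide_simps mult.commute)
qed

lemma seq_dist_triangle:
  assumes "x \<in> seq_space" "y \<in> seq_space" "z \<in> seq_space"
  shows "seq_dist x z \<le> seq_dist x y + seq_dist y z"
proof -
  note s = seq_dist_summable[OF assms(1,2)] seq_dist_summable[OF assms(2,3)]
  have "seq_dist x z \<le> (\<Sum>i. \<bar>x i - y i\<bar> / 2 ^ i + \<bar>y i - z i\<bar> / 2 ^ i)"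
    unfolding seq_dist_def
  proof (rule suminf_le)
    show "\<bar>x i - z i\<bar> / 2 ^ i \<le> \<bar>x i - y i\<bar> / 2 ^ i + \<bar>y i - z i\<bar> / 2 ^ i" for i
      unfolding add_divide_distrib[symmetric] by (rule divide_right_mono) auto
  qed (use s seq_dist_summable[OF assms(1,3)] in \<open>auto intro: summable_add\<close>)
  also have "\<dots> = seq_dist x y + seq_dist y z"
    unfolding seq_dist_def by (rule suminf_add[OF s, symmetric])
  finally show ?thesis .
qed

lemma continuous_on_seq_dist:
  assumes "x \<in> seq_space"
  shows "continuous_on seq_space (seq_dist x)"
proof -
  have "uniform_limit seq_space (\<lambda>n z. \<Sum>i<n. \<bar>x i - z i\<bar> / 2 ^ i)
          (\<lambda>z. \<Sum>i. \<bar>x i - z i\<bar> / 2 ^ i) sequentially"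
    by (rule Weierstrass_m_test[where M = "\<lambda>i. (1/2) ^ i"])
       (use seq_dist_term_le[OF assms] in \<open>auto simp: summable_geometric\<close>)
  moreover have "continuous_on seq_space (\<lambda>z. \<Sum>i<n. \<bar>x i - z i\<bar> / 2 ^ i)" for n
    by (intro continuous_intros continuous_on_subset[OF continuous_on_product_coordinates]) auto
  ultimately have "continuous_on seq_space (\<lambda>z. \<Sum>i. \<bar>x i - z i\<bar> / 2 ^ i)"
    by (intro uniform_limit_theorem[where F = sequentially]) auto
  then show ?thesis by (simp add: seq_dist_def)
qed

lemma openin_seq_space_iff:
  "openin (top_of_set seq_space) U \<longleftrightarrow>
     U \<subseteq> seq_space \<and> (\<forall>x\<in>U. \<exists>r>0. {z \<in> seq_space. seq_dist x z < r} \<subseteq> U)"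
proof (intro iffI conjI ballI)
  assume U: "openin (top_of_set seq_space) U"
  show "U \<subseteq> seq_space" using openin_imp_subset[OF U] .
  fix x assume x: "x \<in> U"
  with \<open>U \<subseteq> seq_space\<close> have xX: "x \<in> seq_space" by auto
  from U obtain V where V: "open V" "U = seq_space \<inter> V" by (auto simp: openin_open)
  have "openin (product_topology (\<lambda>i. euclidean) UNIV) V" "x \<in> V"
    using V x by (auto simp: open_fun_def)
  from product_topology_open_contains_basis[OF this]
  obtain A where A: "x \<in> (\<Pi>\<^sub>E i\<in>UNIV. A i)" "\<And>i. open (A i)" "finite {i. A i \<noteq> UNIV}"
    "(\<Pi>\<^sub>E i\<in>UNIV. A i) \<subseteq> V" by auto
  have "\<exists>e>0. ball (x i) e \<subseteq> A i" for i
    using A(1,2) open_contains_ball[of "A i"] by (auto simp: PiE_iff)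
  then obtain e where e: "\<And>i. e i > 0" "\<And>i. ball (x i) (e i) \<subseteq> A i" by metis
  define J where "J = {i. A i \<noteq> UNIV}"
  define r where "r = Min (insert 1 ((\<lambda>i. e i / 2 ^ i) ` J))"
  have fin: "finite (insert 1 ((\<lambda>i. e i / 2 ^ i) ` J))" using A(3) by (simp add: J_def)
  have r: "r > 0" unfolding r_def using fin e(1) by (subst Min_gr_iff) auto
  have rle: "r \<le> e i / 2 ^ i" if "i \<in> J" for i
    unfolding r_def using fin that by (intro Min_le) auto
  have "{z \<in> seq_space. seq_dist x z < r} \<subseteq> U"
  proof safe
    fix z assume z: "z \<in> seq_space" "seq_dist x z < r"
    have "z i \<in> A i" for i
    proof (cases "i \<in> J")
      case True
      have "\<bar>x i - z i\<bar> \<le> 2 ^ i * seq_dist x z" by (rule seq_dist_coord[OF xX z(1)])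
      also have "\<dots> < 2 ^ i * (e i / 2 ^ i)"
        using z(2) rle[OF True] by (intro mult_strict_left_mono) auto
      finally have "\<bar>x i - z i\<bar> < e i" by simp
      then show ?thesis using e(2)[of i] by (auto simp: dist_real_def)
    qed (auto simp: J_def)
    then have "z \<in> (\<Pi>\<^sub>E i\<in>UNIV. A i)" by auto
    then show "z \<in> U" using A(4) V(2) z(1) by auto
  qed
  with r show "\<exists>r>0. {z \<in> seq_space. seq_dist x z < r} \<subseteq> U" by blast
next
  assume U: "U \<subseteq> seq_space \<and> (\<forall>x\<in>U. \<exists>r>0. {z \<in> seq_space. seq_dist x z < r} \<subseteq> U)"
  show "openin (top_of_set seq_space) U"
  proof (subst openin_subopen, intro ballI)
    fix x assume x: "x \<in> U"
    with U obtain r where r: "r > 0" "{z \<in> seq_space. seq_dist x z < r} \<subseteq> U" by blast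
    have xX: "x \<in> seq_space" using U x by auto
    have "openin (top_of_set seq_space) (seq_space \<inter> seq_dist x -` {..<r})"
      by (rule continuous_openin_preimage_gen[OF continuous_on_seq_dist[OF xX]]) simp
    moreover have "x \<in> seq_space \<inter> seq_dist x -` {..<r}"
      using xX r(1) by (simp add: seq_dist_def)
    moreover have "seq_space \<inter> seq_dist x -` {..<r} \<subseteq> U" using r(2) by auto
    ultimately show "\<exists>T. openin (top_of_set seq_space) T \<and> x \<in> T \<and> T \<subseteq> U" by blast
  qed
qed

section \<open>Invariant measures\<close>

definition seq_borel :: "(nat \<Rightarrow> real) measure" where
  "seq_borel = restrict_space borel seq_space"

definition invariant_measures :: "(nat \<Rightarrow> real) measure set" where
  "invariant_measures =
     {M. prob_space M \<and> sets M = sets seq_borel \<and> distr M M left_shift = M}"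

definition min_ergodic_value :: "((nat \<Rightarrow> real) \<Rightarrow> real) \<Rightarrow> real" where
  "min_ergodic_value \<phi> = (INF M\<in>invariant_measures. \<integral>x. \<phi> x \<partial>M)"

definition minimizing_measures :: "((nat \<Rightarrow> real) \<Rightarrow> real) \<Rightarrow> (nat \<Rightarrow> real) measure set" where
  "minimizing_measures \<phi> =
     {M \<in> invariant_measures. (\<integral>x. \<phi> x \<partial>M) = min_ergodic_value \<phi>}"

definition measure_support :: "(nat \<Rightarrow> real) measure \<Rightarrow> (nat \<Rightarrow> real) set" where
  "measure_support M =
     {x \<in> seq_space. \<forall>U. openin (top_of_set seq_space) U \<longrightarrow> x \<in> U \<longrightarrow> emeasure M U > 0}"

definition periodic_measures :: "(nat \<Rightarrow> real) measure set" where
  "periodic_measures =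
     {M \<in> invariant_measures.
        \<exists>x\<in>seq_space. \<exists>n\<ge>1. (left_shift ^^ n) x = x \<and>
          measure_support M \<subseteq> {(left_shift ^^ i) x | i. i < n}}"

definition mather_set :: "((nat \<Rightarrow> real) \<Rightarrow> real) \<Rightarrow> (nat \<Rightarrow> real) set" where
  "mather_set \<phi> = (\<Union>M\<in>minimizing_measures \<phi>. measure_support M)"

section \<open>The Aubry set\<close>

definition birkhoff_sum :: "nat \<Rightarrow> ((nat \<Rightarrow> real) \<Rightarrow> real) \<Rightarrow> (nat \<Rightarrow> real) \<Rightarrow> real" where
  "birkhoff_sum n \<psi> x = (\<Sum>i<n. \<psi> ((left_shift ^^ i) x))"

definition connecting_set ::
    "(nat \<Rightarrow> real) \<Rightarrow> (nat \<Rightarrow> real) \<Rightarrow> nat \<Rightarrow> real \<Rightarrow> (nat \<Rightarrow> real) set" where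
  "connecting_set x y n \<epsilon> =
     {z \<in> seq_space. seq_dist x z < \<epsilon> \<and> seq_dist ((left_shift ^^ n) z) y < \<epsilon>}"

text \<open>The infimum and the limit are taken in \<^typ>\<open>ereal\<close>: the infimum may be \<open>-\<infinity>\<close> for a general
  \<open>\<phi>\<close>, and the limit may be \<open>\<infinity>\<close>. The limit always exists there, because the infimum is
  nonincreasing in \<open>\<epsilon>\<close>.\<close>

definition mane_potential ::
    "((nat \<Rightarrow> real) \<Rightarrow> real) \<Rightarrow> (nat \<Rightarrow> real) \<Rightarrow> (nat \<Rightarrow> real) \<Rightarrow> ereal" where
  "mane_potential \<phi> x y =
     Lim (at_right 0) (\<lambda>\<epsilon>. Inf {ereal (birkhoff_sum n (\<lambda>w. \<phi> w - min_ergodic_value \<phi>) z) | n z.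
                                  n \<ge> 1 \<and> z \<in> connecting_set x y n \<epsilon>})"

definition aubry_set :: "((nat \<Rightarrow> real) \<Rightarrow> real) \<Rightarrow> (nat \<Rightarrow> real) set" where
  "aubry_set \<phi> = {x \<in> seq_space. mane_potential \<phi> x x = 0}"

section \<open>Smooth functions on the closed unit square\<close>

text \<open>Partial derivatives are taken within the interval \<open>[0,1]\<close>, so they are one-sided at the
  boundary. A function is \<open>C\<^sup>k\<close> on the closed square if all its partial derivatives up to order
  \<open>k\<close> exist in this sense and are continuous up to the boundary.\<close>

abbreviation unit_square :: "(real \<times> real) set" where
  "unit_square \<equiv> {0..1} \<times> {0..1}"

definition partial1 :: "(real \<times> real \<Rightarrow> real) \<Rightarrow> (real \<times> real \<Rightarrow> real)" where
  "partial1 g = (\<lambda>(x, y). vector_derivative (\<lambda>t. g (t, y)) (at x within {0..1}))"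

definition partial2 :: "(real \<times> real \<Rightarrow> real) \<Rightarrow> (real \<times> real \<Rightarrow> real)" where
  "partial2 g = (\<lambda>(x, y). vector_derivative (\<lambda>t. g (x, t)) (at y within {0..1}))"

fun Ck_on_square :: "nat \<Rightarrow> (real \<times> real \<Rightarrow> real) \<Rightarrow> bool" where
  "Ck_on_square 0 g \<longleftrightarrow> continuous_on unit_square g"
| "Ck_on_square (Suc k) g \<longleftrightarrow>
     continuous_on unit_square g \<and>
     (\<forall>x\<in>{0..1}. \<forall>y\<in>{0..1}.
        (\<lambda>t. g (t, y)) differentiable (at x within {0..1}) \<and>
        (\<lambda>t. g (x, t)) differentiable (at y within {0..1})) \<and>
     Ck_on_square k (partial1 g) \<and> Ck_on_square k (partial2 g)"

definition diag_min :: "(real \<times> real \<Rightarrow> real) \<Rightarrow> real" where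
  "diag_min h = (LEAST v. v \<in> (\<lambda>x. h (x, x)) ` {0..1})"

definition diag_minimizers :: "(real \<times> real \<Rightarrow> real) \<Rightarrow> real set" where
  "diag_minimizers h = {a \<in> {0..1}. h (a, a) = diag_min h}"

end

theory Submission
  imports Defs
begin

text \<open>
  The twist condition makes \<open>\<phi>\<close> cohomologous to a function of \<open>(x\<^sub>0,x\<^sub>1)\<close> that is minimal exactly at
  the minimizers of \<open>h\<close> on the diagonal. Let \<open>F\<close> be a primitive of \<open>t \<mapsto> D\<^sub>1h(t,t)\<close>. Since \<open>D\<^sub>1h(x,\<cdot>)\<close> is
  strictly decreasing, \<open>x \<mapsto> h(x,y) - F(x)\<close> has its strict minimum at \<open>x = y\<close>
  (\<open>twist_potential\<close>). Hence the excess
  \<open>W(x,y) = h(x,y) - h\<^sup>* - F(x) + F(y)\<close>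
  is at least \<open>h(y,y) - h\<^sup>*\<close>, so it is nonnegative, and it vanishes only if \<open>x = y\<close> and this
  point minimizes \<open>h\<close> on the diagonal. In other words,
  \<open>\<phi> - h\<^sup>* = W(x\<^sub>0,x\<^sub>1) + F(x\<^sub>0) - F(x\<^sub>1)\<close> is a nonnegative function plus a coboundary.

  For an invariant measure the coboundary integrates to zero, so \<open>\<integral>\<phi> d\<mu> = h\<^sup>* + \<integral>W d\<mu>\<close>. This gives
  \<open>\<alpha> = h\<^sup>*\<close>, attained at constant sequences. For a minimizing measure \<open>W\<close> vanishes almost
  everywhere, and by invariance along almost every orbit, so almost every sequence is constant
  with a minimizing value (\<open>minimizing_AE_const\<close>). If the measure is periodic, its orbit must then be
  a single point; if the minimizer is unique, there is just one minimizing measure.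

  Along an orbit the coboundary telescopes, so \<open>S\<^sub>n(\<phi> - \<alpha>)(z)\<close> is the sum of the excesses of \<open>z\<close> plus
  \<open>F(z\<^sub>0) - F(z\<^sub>n)\<close>. If \<open>z\<close> starts and ends near \<open>x\<close>, the last difference is small, and a point \<open>x\<close> of
  the Aubry set is a limit of orbit segments all of whose excesses tend to zero. Therefore \<open>W\<close>
  vanishes along the orbit of \<open>x\<close> (\<open>aubry_set_excess_zero\<close>) and \<open>x\<close> is again constant.
\<close>

section \<open>The twist condition and a coboundary\<close>

text \<open>\<open>F\<close> is chosen so that the derivative of \<open>x \<mapsto> h(x,y) - F(x)\<close> is \<open>D\<^sub>1h(x,y) - D\<^sub>1h(x,x)\<close>. By the sign of
  \<open>D\<^sub>2D\<^sub>1h\<close> this is negative for \<open>x < y\<close> and positive for \<open>x > y\<close>.\<close>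

lemma twist_potential:
  fixes h :: "real \<times> real \<Rightarrow> real"
  assumes C2: "Ck_on_square 2 h"
    and twist: "\<forall>p\<in>unit_square. partial2 (partial1 h) p < 0"
  obtains F where "continuous_on {0..1} F"
    "\<And>x y. x \<in> {0..1} \<Longrightarrow> y \<in> {0..1} \<Longrightarrow> x \<noteq> y \<Longrightarrow> h (y, y) + F x - F y < h (x, y)"
proof -
  from C2 have
    d1: "\<And>x y. x \<in> {0..1} \<Longrightarrow> y \<in> {0..1} \<Longrightarrow> (\<lambda>t. h (t, y)) differentiable (at x within {0..1})"
    and cont1: "continuous_on unit_square (partial1 h)"
    and d12: "\<And>x y. x \<in> {0..1} \<Longrightarrow> y \<in> {0..1} \<Longrightarrow>
      (\<lambda>t. partial1 h (x, t)) differentiable (at y within {0..1})"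
    by (auto simp: numeral_2_eq_2)
  define F where "F = (\<lambda>u. integral {0..u} (\<lambda>t. partial1 h (t, t)))"
  have D1: "((\<lambda>t. h (t, y)) has_real_derivative partial1 h (x, y)) (at x within {0..1})"
    if "x \<in> {0..1}" "y \<in> {0..1}" for x y
    using d1[OF that] unfolding partial1_def
    by (simp add: has_real_derivative_iff_has_vector_derivative vector_derivative_works)
  have D12: "((\<lambda>t. partial1 h (x, t)) has_real_derivative partial2 (partial1 h) (x, y))
      (at y within {0..1})"
    if "x \<in> {0..1}" "y \<in> {0..1}" for x y
    using d12[OF that] unfolding partial2_def
    by (simp add: has_real_derivative_iff_has_vector_derivative vector_derivative_works)
  have "continuous_on {0..1} (\<lambda>t. partial1 h (t, t))"
    by (rule continuous_on_compose2[OF cont1]) (auto intro!: continuous_intros)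
  then have DF: "(F has_real_derivative partial1 h (x, x)) (at x within {0..1})"
    if "x \<in> {0..1}" for x
    unfolding F_def has_real_derivative_iff_has_vector_derivative
    using that by (rule integral_has_vector_derivative)
  have decr: "partial1 h (x, b) < partial1 h (x, a)"
    if "x \<in> {0..1}" "0 \<le> a" "a < b" "b \<le> 1" for x a b
  proof (rule DERIV_neg_imp_decreasing_open[OF \<open>a < b\<close>])
    show "\<exists>d. ((\<lambda>t. partial1 h (x, t)) has_real_derivative d) (at t) \<and> d < 0"
      if t: "a < t" "t < b" for t
      using D12[of x t] twist that \<open>0 \<le> a\<close> \<open>b \<le> 1\<close> \<open>x \<in> {0..1}\<close> at_within_Icc_at[of 0 t 1]
      by (auto intro!: exI[of _ "partial2 (partial1 h) (x, t)"])
    show "continuous_on {a..b} (\<lambda>t. partial1 h (x, t))"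
      by (rule continuous_on_compose2[OF cont1]) (use that in \<open>auto intro!: continuous_intros\<close>)
  qed
  have Dg: "((\<lambda>t. h (t, y) - F t) has_real_derivative partial1 h (x, y) - partial1 h (x, x))
      (at x within {0..1})" if "x \<in> {0..1}" "y \<in> {0..1}" for x y
    by (rule DERIV_diff[OF D1[OF that] DF[OF that(1)]])
  have contg: "continuous_on {a..b} (\<lambda>t. h (t, y) - F t)"
    if "y \<in> {0..1}" "0 \<le> a" "b \<le> 1" for a b y
    by (rule continuous_on_subset[OF DERIV_continuous_on[OF Dg]]) (use that in auto)
  show thesis
  proof (rule that)
    show "continuous_on {0..1} F" by (rule DERIV_continuous_on[OF DF])
    fix x y :: real assume xy: "x \<in> {0..1}" "y \<in> {0..1}" "x \<noteq> y"
    consider "x < y" | "y < x" using xy by linarith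
    then have "h (y, y) - F y < h (x, y) - F x"
    proof cases
      case 1
      show ?thesis
      proof (rule DERIV_neg_imp_decreasing_open[OF 1 _ contg])
        show "\<exists>d. ((\<lambda>t. h (t, y) - F t) has_real_derivative d) (at t) \<and> d < 0"
          if t: "x < t" "t < y" for t
          using Dg[of t y] decr[of t t y] t xy at_within_Icc_at[of 0 t 1]
          by (auto intro!: exI[of _ "partial1 h (t, y) - partial1 h (t, t)"])
      qed (use xy in auto)
    next
      case 2
      show ?thesis
      proof (rule DERIV_pos_imp_increasing_open[OF 2 _ contg])
        show "\<exists>d. ((\<lambda>t. h (t, y) - F t) has_real_derivative d) (at t) \<and> d > 0"
          if t: "y < t" "t < x" for t
          using Dg[of t y] decr[of t y t] t xy at_within_Icc_at[of 0 t 1]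
          by (auto intro!: exI[of _ "partial1 h (t, y) - partial1 h (t, t)"])
      qed (use xy in auto)
    qed
    then show "h (y, y) + F x - F y < h (x, y)" by simp
  qed
qed

section \<open>Shift-invariant measures on the sequence space\<close>

lemma left_shift_funpow: "(left_shift ^^ n) x = (\<lambda>i. x (n + i))"
  by (induction n) (auto simp: left_shift_def)

lemma seq_space_coord: "x \<in> seq_space \<Longrightarrow> x i \<in> {0..1}"
  by (auto simp: seq_space_def Pi_iff)

lemma left_shift_in_seq_space: "x \<in> seq_space \<Longrightarrow> left_shift x \<in> seq_space"
  by (auto simp: seq_space_def Pi_iff left_shift_def)

lemma left_shift_funpow_in_seq_space: "x \<in> seq_space \<Longrightarrow> (left_shift ^^ n) x \<in> seq_space"
  by (auto simp: seq_space_def Pi_iff left_shift_funpow)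

lemma space_seq_borel [simp]: "space seq_borel = seq_space"
  by (simp add: seq_borel_def space_restrict_space)

lemma openin_seq_space_measurable:
  assumes "openin (top_of_set seq_space) U"
  shows "U \<in> sets seq_borel"
proof -
  obtain V where "open V" "U = seq_space \<inter> V" using assms unfolding openin_open by blast
  then show ?thesis
    unfolding seq_borel_def sets_restrict_space by (intro image_eqI[of _ _ V] borel_open)
qed

lemma left_shift_measurable: "left_shift \<in> seq_borel \<rightarrow>\<^sub>M seq_borel"
proof -
  have "continuous_on UNIV left_shift"
    unfolding left_shift_def
    by (intro continuous_on_coordinatewise_then_product continuous_on_product_coordinates)
  then have "left_shift \<in> borel \<rightarrow>\<^sub>M borel" by (rule borel_measurable_continuous_onI)
  then show ?thesis
    unfolding seq_borel_def
    by (rule measurable_restrict_space3) (auto simp: left_shift_in_seq_space)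
qed

lemma invariant_measuresD:
  assumes "M \<in> invariant_measures"
  shows "prob_space M" "sets M = sets seq_borel" "space M = seq_space"
    "left_shift \<in> M \<rightarrow>\<^sub>M M" "distr M M left_shift = M"
proof -
  show *: "prob_space M" "sets M = sets seq_borel" "distr M M left_shift = M"
    using assms by (auto simp: invariant_measures_def)
  show "space M = seq_space" using sets_eq_imp_space_eq[OF *(2)] by simp
  show "left_shift \<in> M \<rightarrow>\<^sub>M M"
    unfolding measurable_cong_sets[OF *(2) *(2)] by (rule left_shift_measurable)
qed

lemma continuous_integrable:
  fixes f :: "(nat \<Rightarrow> real) \<Rightarrow> real"
  assumes M: "M \<in> invariant_measures" and f: "continuous_on seq_space f"
  shows "integrable M f"
proof -
  interpret prob_space M using invariant_measuresD(1)[OF M] .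
  have "compactin (product_topology (\<lambda>i. euclidean) UNIV) (PiE UNIV (\<lambda>i. {0..1::real}))"
    by (subst compactin_PiE) auto
  then have "compact seq_space"
    by (simp add: seq_space_def euclidean_product_topology PiE_UNIV_domain)
  then have "bounded (f ` seq_space)"
    using compact_continuous_image[OF f] compact_imp_bounded by blast
  then obtain B where "\<And>x. x \<in> seq_space \<Longrightarrow> norm (f x) \<le> B" by (auto simp: bounded_iff)
  moreover have "f \<in> borel_measurable M"
    unfolding measurable_cong_sets[OF invariant_measuresD(2)[OF M] refl]
    unfolding seq_borel_def by (rule borel_measurable_continuous_on_restrict[OF f])
  ultimately show ?thesis
    by (intro integrable_const_bound[where B = B]) (auto simp: invariant_measuresD(3)[OF M])
qed

lemma integral_shift:
  fixes f :: "(nat \<Rightarrow> real) \<Rightarrow> real"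
  assumes M: "M \<in> invariant_measures" and f: "continuous_on seq_space f"
  shows "(\<integral>x. f (left_shift x) \<partial>M) = (\<integral>x. f x \<partial>M)"
  using integral_distr[OF invariant_measuresD(4)[OF M]
      borel_measurable_integrable[OF continuous_integrable[OF M f]]]
  unfolding invariant_measuresD(5)[OF M] by (rule sym)

lemma AE_shift:
  assumes M: "M \<in> invariant_measures" and P: "AE x in M. P x"
  shows "AE x in M. \<forall>n. P ((left_shift ^^ n) x)"
proof -
  have "AE x in M. P ((left_shift ^^ n) x)" for n
  proof (induction n)
    case (Suc n)
    then have "AE x in distr M M left_shift. P ((left_shift ^^ n) x)"
      unfolding invariant_measuresD(5)[OF M] .
    then have "AE x in M. P ((left_shift ^^ n) (left_shift x))"
      by (rule AE_distrD[OF invariant_measuresD(4)[OF M]])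
    then show ?case by (simp add: funpow_Suc_right del: funpow.simps)
  qed (use P in simp)
  then show ?thesis by (simp add: AE_all_countable)
qed

text \<open>The sequence space is second countable, so countably many open null sets cover the complement of
  the support.\<close>

lemma AE_measure_support:
  assumes M: "M \<in> invariant_measures"
  shows "AE x in M. x \<in> measure_support M"
proof -
  define N where "N = {U. openin (top_of_set seq_space) U \<and> emeasure M U = 0}"
  obtain N' where N': "N' \<subseteq> N" "countable N'" "\<Union>N' = \<Union>N"
    by (rule Lindelof_openin[of N seq_space]) (auto simp: N_def)
  have "\<Union>N' \<in> null_sets M"
    unfolding Sup_set_def[symmetric]
  proof (rule null_sets_UN'[of N' "\<lambda>U. U", simplified])
    show "U \<in> null_sets M" if "U \<in> N'" for U
      using that N'(1) openin_seq_space_measurable invariant_measuresD(2)[OF M]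
      by (auto simp: N_def)
  qed (fact N'(2))
  moreover have "{x \<in> space M. \<not> x \<in> measure_support M} \<subseteq> \<Union>N'"
    unfolding N'(3) by (auto simp: N_def measure_support_def invariant_measuresD(3)[OF M])
  ultimately show ?thesis by (rule AE_I')
qed

lemma AE_eq_point_imp_return:
  assumes M: "M \<in> invariant_measures" and p: "AE x in M. x = p"
  shows "M = return seq_borel p"
proof (rule measure_eqI)
  interpret prob_space M using invariant_measuresD(1)[OF M] .
  show "sets M = sets (return seq_borel p)" by (simp add: invariant_measuresD(2)[OF M])
  fix A assume A: "A \<in> sets M"
  have "emeasure M A = indicator A p"
  proof (cases "p \<in> A")
    case True
    with p have "AE x in M. x \<in> A" by auto
    with True show ?thesis using A by (simp add: emeasure_eq_1_AE)
  next
    case False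
    with p have "AE x in M. x \<notin> A" by auto
    moreover have "{x \<in> space M. \<not> x \<notin> A} = A"
      using sets.sets_into_space[OF A] by auto
    ultimately show ?thesis using False AE_iff_measurable[OF A, of "\<lambda>x. x \<notin> A"] by simp
  qed
  then show "emeasure M A = emeasure (return seq_borel p) A"
    using A by (simp add: invariant_measuresD(2)[OF M])
qed

lemma const_in_seq_space: "a \<in> {0..1} \<Longrightarrow> (\<lambda>_. a) \<in> seq_space"
  by (auto simp: seq_space_def)

lemma return_const_invariant:
  assumes "a \<in> {0..1}"
  shows "return seq_borel (\<lambda>_. a) \<in> invariant_measures"
proof -
  have "distr (return seq_borel (\<lambda>_. a)) seq_borel left_shift = return seq_borel (\<lambda>_. a)"
    using distr_return[OF left_shift_measurable, of "\<lambda>_. a"] const_in_seq_space[OF assms]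
    by (simp add: left_shift_def)
  then have "distr (return seq_borel (\<lambda>_. a)) (return seq_borel (\<lambda>_. a)) left_shift
      = return seq_borel (\<lambda>_. a)"
    by (simp cong: distr_cong)
  then show ?thesis
    using const_in_seq_space[OF assms]
    by (simp add: invariant_measures_def prob_space_return)
qed

lemma measure_support_return:
  assumes p: "p \<in> seq_space"
  shows "measure_support (return seq_borel p) = {p}"
proof -
  have emeasure_U: "emeasure (return seq_borel p) U = indicator U p"
    if "openin (top_of_set seq_space) U" for U
    using openin_seq_space_measurable[OF that] by simp
  have "openin (top_of_set seq_space) (seq_space - {p})"
    unfolding openin_open by (intro exI[of _ "- {p}"]) auto
  then have "x = p" if "x \<in> measure_support (return seq_borel p)" for x
    using that emeasure_U[of "seq_space - {p}"] by (auto simp: measure_support_def)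
  moreover have "p \<in> measure_support (return seq_borel p)"
    using p emeasure_U by (simp add: measure_support_def)
  ultimately show ?thesis by blast
qed

lemma return_const_periodic:
  assumes "a \<in> {0..1}"
  shows "return seq_borel (\<lambda>_. a) \<in> periodic_measures"
proof -
  have "\<exists>x\<in>seq_space. \<exists>n\<ge>1. (left_shift ^^ n) x = x \<and>
      measure_support (return seq_borel (\<lambda>_. a)) \<subseteq> {(left_shift ^^ i) x | i. i < n}"
    using const_in_seq_space[OF assms]
    by (intro bexI[of _ "\<lambda>_. a"] exI[of _ "1::nat"])
       (auto simp: measure_support_return left_shift_def)
  then show ?thesis
    using return_const_invariant[OF assms] by (simp add: periodic_measures_def)
qed

section \<open>The Mane potential\<close>

text \<open>The infimum whose limit as \<open>\<epsilon> \<rightarrow> 0\<close> is the Mane potential. It grows as \<open>\<epsilon>\<close> decreases, hence the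
  limit is also its supremum; this turns information about the potential into information about
  each single \<open>\<epsilon>\<close>.\<close>

definition mane_inf :: "((nat \<Rightarrow> real) \<Rightarrow> real) \<Rightarrow> (nat \<Rightarrow> real) \<Rightarrow> (nat \<Rightarrow> real) \<Rightarrow> real \<Rightarrow> ereal" where
  "mane_inf \<phi> x y \<epsilon> = Inf {ereal (birkhoff_sum n (\<lambda>w. \<phi> w - min_ergodic_value \<phi>) z) | n z.
                              n \<ge> 1 \<and> z \<in> connecting_set x y n \<epsilon>}"

lemma mane_potential_eq: "mane_potential \<phi> x y = Lim (at_right 0) (mane_inf \<phi> x y)"
  by (simp add: mane_potential_def mane_inf_def[abs_def])

lemma mane_inf_antimono: "\<epsilon> \<le> \<epsilon>' \<Longrightarrow> mane_inf \<phi> x y \<epsilon>' \<le> mane_inf \<phi> x y \<epsilon>"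
  unfolding mane_inf_def by (rule Inf_superset_mono) (fastforce simp: connecting_set_def)

lemma mane_inf_le_potential:
  assumes "\<epsilon> > 0"
  shows "mane_inf \<phi> x y \<epsilon> \<le> mane_potential \<phi> x y"
proof -
  let ?f = "mane_inf \<phi> x y"
  have "(?f \<longlongrightarrow> (SUP \<epsilon>\<in>{0<..}. ?f \<epsilon>)) (at_right 0)"
  proof (rule order_tendstoI)
    fix c assume "c < (SUP \<epsilon>\<in>{0<..}. ?f \<epsilon>)"
    then obtain e where e: "e > 0" "c < ?f e" by (auto simp: less_SUP_iff)
    show "\<forall>\<^sub>F t in at_right 0. c < ?f t"
      using e(1)
      by (intro eventually_at_rightI[of 0 e])
         (auto intro: less_le_trans[OF e(2) mane_inf_antimono])
  next
    fix c assume c: "(SUP \<epsilon>\<in>{0<..}. ?f \<epsilon>) < c"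
    show "\<forall>\<^sub>F t in at_right 0. ?f t < c"
      by (rule eventually_at_rightI[of 0 1]) (auto intro: le_less_trans[OF SUP_upper c])
  qed
  then have "mane_potential \<phi> x y = (SUP \<epsilon>\<in>{0<..}. ?f \<epsilon>)"
    unfolding mane_potential_eq by (intro tendsto_Lim) auto
  then show ?thesis using assms by (auto intro: SUP_upper)
qed

section \<open>Minimization of a twisted nearest-neighbour interaction\<close>

text \<open>The hypothesis \<open>twist_less\<close> is the integrated form of the twist condition: \<open>h\<close> exceeds its value on
  the diagonal strictly, up to a coboundary.\<close>

locale twist_interaction =
  fixes h :: "real \<times> real \<Rightarrow> real" and F :: "real \<Rightarrow> real" and \<phi> :: "(nat \<Rightarrow> real) \<Rightarrow> real"
  assumes cont_h: "continuous_on unit_square h"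
    and cont_F: "continuous_on {0..1} F"
    and twist_less: "\<And>x y. x \<in> {0..1} \<Longrightarrow> y \<in> {0..1} \<Longrightarrow> x \<noteq> y \<Longrightarrow> h (y, y) + F x - F y < h (x, y)"
    and phi_eq: "\<And>x. x \<in> seq_space \<Longrightarrow> \<phi> x = h (x 0, x 1)"
begin

definition excess :: "real \<times> real \<Rightarrow> real" where
  "excess p = h p - diag_min h - F (fst p) + F (snd p)"

lemma diag_min_attained:
  obtains a where "a \<in> diag_minimizers h" "\<And>x. x \<in> {0..1} \<Longrightarrow> diag_min h \<le> h (x, x)"
proof -
  have "continuous_on {0..1} (\<lambda>x. h (x, x))"
    by (rule continuous_on_compose2[OF cont_h]) (auto intro!: continuous_intros)
  then obtain a where a: "a \<in> {0..1}" "\<And>x. x \<in> {0..1} \<Longrightarrow> h (a, a) \<le> h (x, x)"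
    using continuous_attains_inf[of "{0..1::real}" "\<lambda>x. h (x, x)"] by auto
  then have "diag_min h = h (a, a)"
    unfolding diag_min_def by (intro Least_equality) auto
  with a show thesis by (intro that[of a]) (auto simp: diag_minimizers_def)
qed

lemma diag_min_le: "x \<in> {0..1} \<Longrightarrow> diag_min h \<le> h (x, x)"
  using diag_min_attained by metis

lemma excess_nonneg:
  assumes "x \<in> {0..1}" "y \<in> {0..1}"
  shows "0 \<le> excess (x, y)"
  using twist_less[OF assms] diag_min_le[OF assms(2)]
  by (cases "x = y") (auto simp: excess_def)

lemma excess_eq_0D:
  assumes "x \<in> {0..1}" "y \<in> {0..1}" "excess (x, y) \<le> 0"
  shows "x = y" "y \<in> diag_minimizers h"
proof -
  show "x = y"
    using twist_less[OF assms(1,2)] diag_min_le[OF assms(2)] assms(3)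
    by (cases "x = y") (auto simp: excess_def)
  then show "y \<in> diag_minimizers h"
    using assms diag_min_le[OF assms(2)] by (auto simp: excess_def diag_minimizers_def)
qed

lemma continuous_excess: "continuous_on unit_square excess"
  unfolding excess_def
  by (intro continuous_intros cont_h continuous_on_compose2[OF cont_F]) auto

lemma phi_decomposition:
  assumes "x \<in> seq_space"
  shows "\<phi> x = diag_min h + excess (x 0, x 1) + F (x 0) - F (left_shift x 0)"
  using assms by (simp add: excess_def phi_eq left_shift_def)

lemma continuous_on_coord: "continuous_on S (\<lambda>x::nat \<Rightarrow> real. x i)"
  by (rule continuous_on_subset[OF continuous_on_product_coordinates]) auto

lemma continuous_excess_seq: "continuous_on seq_space (\<lambda>x. excess (x 0, x 1))"
  by (rule continuous_on_compose2[OF continuous_excess])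
     (use seq_space_coord in \<open>auto intro!: continuous_intros continuous_on_coord\<close>)

lemma continuous_F_seq: "continuous_on seq_space (\<lambda>x. F (x i))"
  by (rule continuous_on_compose2[OF cont_F])
     (use seq_space_coord in \<open>auto intro!: continuous_on_coord\<close>)

lemma integral_phi:
  assumes M: "M \<in> invariant_measures"
  shows "(\<integral>x. \<phi> x \<partial>M) = diag_min h + (\<integral>x. excess (x 0, x 1) \<partial>M)"
proof -
  interpret prob_space M using invariant_measuresD(1)[OF M] .
  note int = continuous_integrable[OF M]
  have F1: "integrable M (\<lambda>x. F (left_shift x 0))"
    using int[OF continuous_F_seq[of 1]] by (simp add: left_shift_def)
  have "(\<integral>x. \<phi> x \<partial>M) =
      (\<integral>x. diag_min h + excess (x 0, x 1) + F (x 0) - F (left_shift x 0) \<partial>M)"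
    by (rule Bochner_Integration.integral_cong)
       (auto simp: invariant_measuresD(3)[OF M] phi_decomposition)
  also have "\<dots> = diag_min h + (\<integral>x. excess (x 0, x 1) \<partial>M)
      + (\<integral>x. F (x 0) \<partial>M) - (\<integral>x. F (left_shift x 0) \<partial>M)"
    using int[OF continuous_excess_seq] int[OF continuous_F_seq[of 0]] F1
    by (simp add: prob_space)
  also have "(\<integral>x. F (left_shift x 0) \<partial>M) = (\<integral>x. F (x 0) \<partial>M)"
    by (rule integral_shift[OF M continuous_F_seq])
  finally show ?thesis by simp
qed

lemma diag_min_le_integral:
  assumes M: "M \<in> invariant_measures"
  shows "diag_min h \<le> (\<integral>x. \<phi> x \<partial>M)"
  unfolding integral_phi[OF M]
  using Bochner_Integration.integral_nonneg[of M "\<lambda>x. excess (x 0, x 1)"]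
    excess_nonneg seq_space_coord invariant_measuresD(3)[OF M]
  by auto

lemma integral_return_const:
  assumes a: "a \<in> diag_minimizers h"
  shows "(\<integral>x. \<phi> x \<partial>return seq_borel (\<lambda>_. a)) = diag_min h"
proof -
  have a01: "a \<in> {0..1}" and ha: "h (a, a) = diag_min h"
    using a by (auto simp: diag_minimizers_def)
  have "continuous_on seq_space (\<lambda>x. excess (x 0, x 1))" by (rule continuous_excess_seq)
  then have "(\<lambda>x. excess (x 0, x 1)) \<in> borel_measurable seq_borel"
    unfolding seq_borel_def by (rule borel_measurable_continuous_on_restrict)
  then have "(\<integral>x. excess (x 0, x 1) \<partial>return seq_borel (\<lambda>_. a)) = 0"
    using const_in_seq_space[OF a01] ha by (simp add: integral_return excess_def)
  then show ?thesis by (simp add: integral_phi[OF return_const_invariant[OF a01]])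
qed

lemma min_ergodic_value_eq: "min_ergodic_value \<phi> = diag_min h"
proof -
  obtain a where a: "a \<in> diag_minimizers h" by (rule diag_min_attained)
  then have inv: "return seq_borel (\<lambda>_. a) \<in> invariant_measures"
    by (intro return_const_invariant) (auto simp: diag_minimizers_def)
  show ?thesis
    unfolding min_ergodic_value_def
  proof (rule cInf_eq_minimum)
    show "diag_min h \<in> (\<lambda>M. \<integral>x. \<phi> x \<partial>M) ` invariant_measures"
      using integral_return_const[OF a] inv by (auto intro!: image_eqI[rotated])
  qed (use diag_min_le_integral in auto)
qed

lemma return_const_minimizing:
  assumes "a \<in> diag_minimizers h"
  shows "return seq_borel (\<lambda>_. a) \<in> minimizing_measures \<phi>"
  using assms integral_return_const[OF assms] return_const_invariant[of a]
  by (auto simp: minimizing_measures_def min_ergodic_value_eq diag_minimizers_def)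

lemma excess_zero_imp_const:
  assumes x: "x \<in> seq_space" and z: "\<And>i. excess (x i, x (Suc i)) \<le> 0"
  shows "\<exists>a\<in>diag_minimizers h. x = (\<lambda>_. a)"
proof -
  note D = excess_eq_0D[OF seq_space_coord[OF x] seq_space_coord[OF x] z]
  have "x i = x 0" for i
    by (induction i) (use D(1) in auto)
  then have "x = (\<lambda>_. x 0)" by (rule ext)
  moreover have "x 0 \<in> diag_minimizers h" using D[of 0] by simp
  ultimately show ?thesis by blast
qed

text \<open>A nonnegative function with integral zero vanishes almost everywhere, and invariance propagates
  this to all iterates of the shift.\<close>

lemma minimizing_AE_const:
  assumes M: "M \<in> minimizing_measures \<phi>"
  shows "AE x in M. \<exists>a\<in>diag_minimizers h. x = (\<lambda>_. a)"
proof -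
  have inv: "M \<in> invariant_measures" and "(\<integral>x. \<phi> x \<partial>M) = diag_min h"
    using M by (auto simp: minimizing_measures_def min_ergodic_value_eq)
  then have "(\<integral>x. excess (x 0, x 1) \<partial>M) = 0" by (simp add: integral_phi)
  moreover have "AE x in M. 0 \<le> excess (x 0, x 1)"
    using excess_nonneg seq_space_coord invariant_measuresD(3)[OF inv] by (auto intro!: AE_I2)
  ultimately have "AE x in M. excess (x 0, x 1) = 0"
    using integral_nonneg_eq_0_iff_AE continuous_integrable[OF inv continuous_excess_seq] by blast
  from AE_shift[OF inv this]
  have "AE x in M. \<forall>i. excess (x i, x (Suc i)) = 0" by (simp add: left_shift_funpow)
  with AE_space show ?thesis
  proof eventually_elim
    case (elim x)
    then show ?case
      by (intro excess_zero_imp_const) (auto simp: invariant_measuresD(3)[OF inv])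
  qed
qed

text \<open>Almost every point is fixed by the shift and lies in the support, which is contained in a periodic
  orbit. A periodic orbit that contains a fixed point consists of that point alone.\<close>

lemma minimizing_periodic:
  "minimizing_measures \<phi> \<inter> periodic_measures
     = {return seq_borel (\<lambda>_. a) | a. a \<in> diag_minimizers h}"
proof (intro equalityI subsetI)
  fix M assume "M \<in> minimizing_measures \<phi> \<inter> periodic_measures"
  then have M: "M \<in> minimizing_measures \<phi>" and inv: "M \<in> invariant_measures"
    and "M \<in> periodic_measures" by (auto simp: minimizing_measures_def)
  then obtain x n where per: "(left_shift ^^ n) x = x"
    and supp: "measure_support M \<subseteq> {(left_shift ^^ i) x | i. i < n}"
    by (auto simp: periodic_measures_def)
  interpret prob_space M using invariant_measuresD(1)[OF inv] .
  have ae: "AE y in M. y \<in> measure_support M \<and> (\<exists>a\<in>diag_minimizers h. y = (\<lambda>_. a))"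
    using AE_measure_support[OF inv] minimizing_AE_const[OF M] by eventually_elim auto
  then obtain y a where y: "y \<in> measure_support M" and a: "a \<in> diag_minimizers h" "y = (\<lambda>_. a)"
    using eventually_happens'[OF _ ae] by (auto simp: ae_filter_eq_bot_iff emeasure_space_1)
  from y supp obtain i where i: "i < n" "y = (left_shift ^^ i) x" by auto
  have fixed: "(left_shift ^^ k) y = y" for k
    by (simp add: a(2) left_shift_funpow)
  have "x = (left_shift ^^ (n - i)) y"
    using i per funpow_add[of "n - i" i left_shift] by simp
  then have "x = y" by (simp add: fixed)
  with supp fixed have "measure_support M \<subseteq> {y}" by auto
  with AE_measure_support[OF inv] have "AE z in M. z = y" by auto
  then have "M = return seq_borel y" by (rule AE_eq_point_imp_return[OF inv])
  with a show "M \<in> {return seq_borel (\<lambda>_. a) | a. a \<in> diag_minimizers h}" by blast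
next
  fix M assume "M \<in> {return seq_borel (\<lambda>_. a) | a. a \<in> diag_minimizers h}"
  then obtain a where "a \<in> diag_minimizers h" "M = return seq_borel (\<lambda>_. a)" by blast
  then show "M \<in> minimizing_measures \<phi> \<inter> periodic_measures"
    using return_const_minimizing[of a] return_const_periodic[of a]
    by (simp add: diag_minimizers_def)
qed

lemma mather_set_unique:
  assumes a: "diag_minimizers h = {a}"
  shows "mather_set \<phi> = {\<lambda>_. a}"
proof -
  have a01: "a \<in> {0..1}" using a by (auto simp: diag_minimizers_def)
  have "M = return seq_borel (\<lambda>_. a)" if M: "M \<in> minimizing_measures \<phi>" for M
  proof (rule AE_eq_point_imp_return)
    show "M \<in> invariant_measures" using M by (auto simp: minimizing_measures_def)
    show "AE x in M. x = (\<lambda>_. a)"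
      using minimizing_AE_const[OF M] by eventually_elim (use a in auto)
  qed
  then have minimizing_eq: "minimizing_measures \<phi> = {return seq_borel (\<lambda>_. a)}"
    using return_const_minimizing[of a] unfolding a by blast
  show ?thesis
    unfolding mather_set_def minimizing_eq
    by (simp add: measure_support_return[OF const_in_seq_space[OF a01]])
qed

text \<open>The coboundary telescopes.\<close>

lemma birkhoff_sum_eq:
  assumes z: "z \<in> seq_space"
  shows "birkhoff_sum n (\<lambda>w. \<phi> w - min_ergodic_value \<phi>) z
    = (\<Sum>i<n. excess (z i, z (Suc i))) + F (z 0) - F (z n)"
proof (induction n)
  case (Suc n)
  have "\<phi> ((left_shift ^^ n) z) = h (z n, z (Suc n))"
    using phi_eq[OF left_shift_funpow_in_seq_space[OF z]] by (simp add: left_shift_funpow)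
  with Suc show ?case
    by (simp add: birkhoff_sum_def excess_def min_ergodic_value_eq)
qed (simp add: birkhoff_sum_def)

lemma connecting_set_coord:
  assumes x: "x \<in> seq_space" and z: "z \<in> connecting_set x x n \<epsilon>"
  shows "\<bar>z i - x i\<bar> \<le> 2 ^ i * \<epsilon>" "\<bar>z (n + i) - x i\<bar> \<le> 2 ^ i * \<epsilon>"
proof -
  have z: "z \<in> seq_space" "seq_dist x z < \<epsilon>" "seq_dist ((left_shift ^^ n) z) x < \<epsilon>"
    using z by (auto simp: connecting_set_def)
  have "\<bar>x i - z i\<bar> \<le> 2 ^ i * seq_dist x z" by (rule seq_dist_coord[OF x z(1)])
  also have "\<dots> \<le> 2 ^ i * \<epsilon>" using z(2) by simp
  finally show "\<bar>z i - x i\<bar> \<le> 2 ^ i * \<epsilon>" by (simp add: abs_minus_commute)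
  have "\<bar>(left_shift ^^ n) z i - x i\<bar> \<le> 2 ^ i * seq_dist ((left_shift ^^ n) z) x"
    by (rule seq_dist_coord[OF left_shift_funpow_in_seq_space[OF z(1)] x])
  also have "\<dots> \<le> 2 ^ i * \<epsilon>" using z(3) by simp
  finally show "\<bar>z (n + i) - x i\<bar> \<le> 2 ^ i * \<epsilon>" by (simp add: left_shift_funpow)
qed

text \<open>The excess at \<open>(x\<^sub>i, x\<^sub>i\<^sub>+\<^sub>1)\<close> is approximated by excesses along segments \<open>z\<close> of length \<open>n\<close> that
  start and end near \<open>x\<close> and have small Birkhoff sum. A segment with \<open>n > i\<close> has a pair close to
  \<open>(x\<^sub>i, x\<^sub>i\<^sub>+\<^sub>1)\<close>, and its excess is at most the Birkhoff sum plus \<open>F(z\<^sub>n) - F(z\<^sub>0)\<close>.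
  The lengths may stay bounded, however. If \<open>n \<le> i\<close>, then \<open>x\<close> nearly returns to itself after \<open>n\<close> steps, so \<open>(x\<^sub>i, x\<^sub>i\<^sub>+\<^sub>1)\<close> is close to
  \<open>(x\<^sub>i\<^sub>-\<^sub>n, x\<^sub>i\<^sub>+\<^sub>1\<^sub>-\<^sub>n)\<close>, whose excess is zero by induction on \<open>i\<close>.\<close>

lemma aubry_set_excess_zero:
  assumes xO: "x \<in> aubry_set \<phi>"
  shows "excess (x i, x (Suc i)) \<le> 0"
proof (induction i rule: less_induct)
  case (less i)
  have x: "x \<in> seq_space" and pot: "mane_potential \<phi> x x = 0"
    using xO by (auto simp: aubry_set_def)
  define e where "e k = 1 / real (Suc k)" for k
  have e0: "e \<longlonglongrightarrow> 0" unfolding e_def by (rule LIMSEQ_Suc[OF lim_1_over_n])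
  have epos: "e k > 0" for k by (simp add: e_def)
  have "\<exists>n z. n \<ge> 1 \<and> z \<in> connecting_set x x n (e k) \<and>
      birkhoff_sum n (\<lambda>w. \<phi> w - min_ergodic_value \<phi>) z < e k" for k
  proof -
    have "mane_inf \<phi> x x (e k) < ereal (e k)"
      using mane_inf_le_potential[OF epos, of \<phi> x x] pot epos[of k]
      by (metis ereal_less(2) le_less_trans)
    then show ?thesis unfolding mane_inf_def Inf_less_iff by fastforce
  qed
  then obtain n z where n: "\<And>k. n k \<ge> 1" and zc: "\<And>k. z k \<in> connecting_set x x (n k) (e k)"
    and small: "\<And>k. birkhoff_sum (n k) (\<lambda>w. \<phi> w - min_ergodic_value \<phi>) (z k) < e k"
    by metis
  have z: "z k \<in> seq_space" for k using zc[of k] by (simp add: connecting_set_def)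
  note coord = connecting_set_coord[OF x zc]
  have squeeze: "u \<longlonglongrightarrow> c" if "\<And>k. \<bar>u k - c\<bar> \<le> 2 ^ j * e k" for u c and j :: nat
  proof (rule LIM_zero_cancel, rule tendsto_0_le[where K = "2 ^ j"])
    show "e \<longlonglongrightarrow> 0" by (rule e0)
    show "\<forall>\<^sub>F k in sequentially. norm (u k - c) \<le> norm (e k) * 2 ^ j"
      using that epos by (auto simp: mult.commute less_imp_le)
  qed
  \<comment> \<open>the approximating pair, according to whether the segment is longer than \<open>i\<close>\<close>
  define s where "s k = (if i < n k then (z k i, z k (Suc i)) else (x (i - n k), x (Suc i - n k)))"
    for k
  have s_sq: "s k \<in> unit_square" for k
    using seq_space_coord[OF z] seq_space_coord[OF x] by (auto simp: s_def)
  have return_near: "\<bar>x (j - n k) - x j\<bar> \<le> 2 ^ Suc j * e k" if "n k \<le> j" for j k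
  proof -
    have "\<bar>z k j - x (j - n k)\<bar> \<le> 2 ^ (j - n k) * e k"
      using coord(2)[of k "j - n k"] that by simp
    also have "\<dots> \<le> 2 ^ j * e k" using epos[of k] by (intro mult_right_mono) auto
    finally show ?thesis using coord(1)[of k j] by simp
  qed
  have z_near: "\<bar>z k j - x j\<bar> \<le> 2 ^ Suc j * e k" for j k
    using coord(1)[of k j] mult_pos_pos[OF _ epos[of k], of "2 ^ j"] by simp
  have "(\<lambda>k. fst (s k)) \<longlonglongrightarrow> x i"
    by (rule squeeze[of _ _ "Suc i"]) (use z_near return_near[of _ i] in \<open>auto simp: s_def\<close>)
  moreover have "(\<lambda>k. snd (s k)) \<longlonglongrightarrow> x (Suc i)"
    by (rule squeeze[of _ _ "Suc (Suc i)"])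
       (use z_near[of _ "Suc i"] return_near[of _ "Suc i"] in \<open>auto simp: s_def\<close>)
  ultimately have s_lim: "s \<longlonglongrightarrow> (x i, x (Suc i))"
    using tendsto_Pair by fastforce
  have excess_lim: "(\<lambda>k. excess (s k)) \<longlonglongrightarrow> excess (x i, x (Suc i))"
    using continuous_excess s_lim s_sq seq_space_coord[OF x]
    by (intro continuous_on_tendsto_compose[OF continuous_excess s_lim]) auto
  have F_lim: "(\<lambda>k. F (u k)) \<longlonglongrightarrow> F (x 0)" if "u \<longlonglongrightarrow> x 0" "\<And>k. u k \<in> {0..1}" for u
    using that seq_space_coord[OF x]
    by (intro continuous_on_tendsto_compose[OF cont_F that(1)]) auto
  have "(\<lambda>k. F (z k 0)) \<longlonglongrightarrow> F (x 0)"
    by (rule F_lim[OF squeeze[of _ _ 0]]) (use coord(1)[of _ 0] seq_space_coord[OF z] in auto)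
  moreover have "(\<lambda>k. F (z k (n k))) \<longlonglongrightarrow> F (x 0)"
    by (rule F_lim[OF squeeze[of _ _ 0]]) (use coord(2)[of _ 0] seq_space_coord[OF z] in auto)
  ultimately have bound_lim: "(\<lambda>k. e k + F (z k (n k)) - F (z k 0)) \<longlonglongrightarrow> 0"
    using e0 by (auto intro!: tendsto_eq_intros)
  have "excess (s k) \<le> e k + F (z k (n k)) - F (z k 0)" for k
  proof -
    have nonneg: "0 \<le> excess (z k j, z k (Suc j))" for j
      using excess_nonneg seq_space_coord[OF z] by auto
    have sum_le: "(\<Sum>j<n k. excess (z k j, z k (Suc j))) \<le> e k + F (z k (n k)) - F (z k 0)"
      using small[of k] by (simp add: birkhoff_sum_eq[OF z])
    have "excess (s k) \<le> (\<Sum>j<n k. excess (z k j, z k (Suc j)))"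
    proof (cases "i < n k")
      case True
      then show ?thesis
        using member_le_sum[of i "{..<n k}" "\<lambda>j. excess (z k j, z k (Suc j))"] nonneg
        by (simp add: s_def)
    next
      case False
      then have "excess (s k) \<le> 0"
        using less[of "i - n k"] n[of k] by (simp add: s_def Suc_diff_le)
      also have "0 \<le> (\<Sum>j<n k. excess (z k j, z k (Suc j)))" by (intro sum_nonneg nonneg)
      finally show ?thesis .
    qed
    with sum_le show ?thesis by linarith
  qed
  then show ?case by (intro LIMSEQ_le[OF excess_lim bound_lim]) auto
qed

lemma aubry_set_const:
  assumes "x \<in> aubry_set \<phi>"
  shows "\<exists>a\<in>diag_minimizers h. x = (\<lambda>_. a)"
  using assms aubry_set_excess_zero[OF assms]
  by (intro excess_zero_imp_const) (auto simp: aubry_set_def)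

text \<open>The constant sequence itself is a connecting orbit with Birkhoff sum zero. Conversely, all excesses are
  nonnegative, so an orbit segment from a neighbourhood of \<open>a\<^sup>\<infinity>\<close> back to it has Birkhoff sum at least
  \<open>F(z\<^sub>0) - F(z\<^sub>n)\<close>, which is small because \<open>F\<close> is continuous at \<open>a\<close>.\<close>

lemma const_in_aubry_set:
  assumes a: "a \<in> diag_minimizers h"
  shows "(\<lambda>_. a) \<in> aubry_set \<phi>"
proof -
  let ?p = "(\<lambda>_. a) :: nat \<Rightarrow> real"
  have a01: "a \<in> {0..1}" and ha: "h (a, a) = diag_min h"
    using a by (auto simp: diag_minimizers_def)
  note p = const_in_seq_space[OF a01]
  have upper: "mane_inf \<phi> ?p ?p \<epsilon> \<le> 0" if "\<epsilon> > 0" for \<epsilon>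
    unfolding mane_inf_def
  proof (rule Inf_lower, rule CollectI, intro exI conjI)
    show "?p \<in> connecting_set ?p ?p 1 \<epsilon>"
      using p that by (simp add: connecting_set_def seq_dist_def left_shift_def)
    show "0 = ereal (birkhoff_sum 1 (\<lambda>w. \<phi> w - min_ergodic_value \<phi>) ?p)"
      using ha by (simp add: birkhoff_sum_eq[OF p] excess_def)
  qed simp
  have lower: "\<exists>\<delta>>0. \<forall>\<epsilon>. \<epsilon> < \<delta> \<longrightarrow> ereal (- \<eta>) \<le> mane_inf \<phi> ?p ?p \<epsilon>" if \<eta>: "\<eta> > 0" for \<eta>
  proof -
    obtain \<delta> where \<delta>: "\<delta> > 0"
      "\<And>t. t \<in> {0..1} \<Longrightarrow> \<bar>t - a\<bar> < \<delta> \<Longrightarrow> \<bar>F t - F a\<bar> < \<eta> / 2"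
      using cont_F a01 half_gt_zero[OF \<eta>] unfolding continuous_on_iff dist_real_def by blast
    have "ereal (- \<eta>) \<le> mane_inf \<phi> ?p ?p \<epsilon>" if "\<epsilon> < \<delta>" for \<epsilon>
      unfolding mane_inf_def
    proof (rule Inf_greatest, safe)
      fix n z assume zc: "z \<in> connecting_set ?p ?p n \<epsilon>"
      then have z: "z \<in> seq_space" by (simp add: connecting_set_def)
      have "\<bar>z 0 - a\<bar> < \<delta>" "\<bar>z n - a\<bar> < \<delta>"
        using connecting_set_coord[OF p zc, of 0] \<open>\<epsilon> < \<delta>\<close> by simp_all
      then have "\<bar>F (z 0) - F a\<bar> < \<eta> / 2" "\<bar>F (z n) - F a\<bar> < \<eta> / 2"
        using \<delta>(2) seq_space_coord[OF z] by simp_all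
      moreover have "0 \<le> (\<Sum>i<n. excess (z i, z (Suc i)))"
        using excess_nonneg seq_space_coord[OF z] by (intro sum_nonneg) auto
      ultimately show "ereal (- \<eta>) \<le> ereal (birkhoff_sum n (\<lambda>w. \<phi> w - min_ergodic_value \<phi>) z)"
        unfolding birkhoff_sum_eq[OF z] ereal_less_eq by arith
    qed
    with \<delta>(1) show ?thesis by blast
  qed
  have "(mane_inf \<phi> ?p ?p \<longlongrightarrow> 0) (at_right 0)"
  proof (rule order_tendstoI)
    fix c :: ereal assume "c < 0"
    then obtain r where r: "c < ereal r" "ereal r < 0" using ereal_dense2 by blast
    then obtain \<delta> where \<delta>: "\<delta> > 0" "\<And>\<epsilon>. \<epsilon> < \<delta> \<Longrightarrow> ereal r \<le> mane_inf \<phi> ?p ?p \<epsilon>"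
      using lower[of "- r"] by auto
    show "\<forall>\<^sub>F \<epsilon> in at_right 0. c < mane_inf \<phi> ?p ?p \<epsilon>"
      using \<delta> by (intro eventually_at_rightI[of 0 \<delta>]) (auto intro: less_le_trans[OF r(1)])
  next
    fix c :: ereal assume "0 < c"
    then show "\<forall>\<^sub>F \<epsilon> in at_right 0. mane_inf \<phi> ?p ?p \<epsilon> < c"
      by (intro eventually_at_rightI[of 0 1]) (auto intro: le_less_trans[OF upper])
  qed
  then have "mane_potential \<phi> ?p ?p = 0"
    unfolding mane_potential_eq by (intro tendsto_Lim) auto
  with p show ?thesis by (simp add: aubry_set_def)
qed

lemma aubry_set_unique:
  assumes "diag_minimizers h = {a}"
  shows "aubry_set \<phi> = {\<lambda>_. a}"
proof (intro equalityI subsetI)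
  fix x assume "x \<in> aubry_set \<phi>"
  from aubry_set_const[OF this] show "x \<in> {\<lambda>_. a}" unfolding assms by blast
next
  fix x :: "nat \<Rightarrow> real" assume "x \<in> {\<lambda>_. a}"
  then show "x \<in> aubry_set \<phi>" using const_in_aubry_set[of a] assms by simp
qed

end

theorem theorem3:
  fixes h :: "real \<times> real \<Rightarrow> real" and \<phi> :: "(nat \<Rightarrow> real) \<Rightarrow> real"
  assumes C2: "Ck_on_square 2 h"
    and twist: "\<forall>p\<in>unit_square. partial2 (partial1 h) p < 0"
    and phi: "\<forall>x\<in>seq_space. \<phi> x = h (x 0, x 1)"
  shows "min_ergodic_value \<phi> = diag_min h
    \<and> minimizing_measures \<phi> \<inter> periodic_measures
        = {return seq_borel (\<lambda>_. a) | a. a \<in> diag_minimizers h}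
    \<and> aubry_set \<phi> \<subseteq> (UNIV \<rightarrow> diag_minimizers h)
    \<and> (\<forall>a. diag_minimizers h = {a} \<longrightarrow>
          mather_set \<phi> = aubry_set \<phi> \<and> aubry_set \<phi> = {\<lambda>_. a})"
proof -
  obtain F where F: "continuous_on {0..1} F"
    "\<And>x y. x \<in> {0..1} \<Longrightarrow> y \<in> {0..1} \<Longrightarrow> x \<noteq> y \<Longrightarrow> h (y, y) + F x - F y < h (x, y)"
    using twist_potential[OF C2 twist] by blast
  interpret twist_interaction h F \<phi>
    using C2 F phi by unfold_locales (auto simp: numeral_2_eq_2)
  have "aubry_set \<phi> \<subseteq> (UNIV \<rightarrow> diag_minimizers h)"
  proof
    fix x assume "x \<in> aubry_set \<phi>"
    from aubry_set_const[OF this] show "x \<in> UNIV \<rightarrow> diag_minimizers h" by blast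
  qed
  then show ?thesis
    using min_ergodic_value_eq minimizing_periodic mather_set_unique aubry_set_unique
    by (intro conjI allI impI) simp_all
qed

end
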